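(* Let $n\ge 3$ and let $p_n(x)=\det(xI-C)$ be the characteristic polynomial of the $n\times n$ affine Cartan matrix $C$ of type $C_{n-1}^{(1)}$. Then $$p_n(x)=x(x-4)\sum_{j=0}^{n-2}(-1)^{n+j}\binom{n+j-1}{2j+1}x^j .$$
   Context: The $n\times n$ matrix $C=(C_{i,j})_{1\le i,j\le n}$ of type $C_{n-1}^{(1)}$ is tridiagonal with $C_{i,i}=2$ for all $i$, $C_{1,2}=-2$, $C_{2,1}=-1$, $C_{i,i+1}=C_{i+1,i}=-1$ for $2\le i\le n-2$, $C_{n-1,n}=-1$, $C_{n,n-1}=-2$, and all other entries $0$. *)

theory Defs
  imports "Jordan_Normal_Form.Char_Poly"
begin

(* Rows and columns are numbered from 1 here, as in the usual numbering of the Dynkin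
   diagram; the values are the intended ones for n \<ge> 3 and 1 \<le> i, j \<le> n. *)
definition affine_C_entry :: "nat \<Rightarrow> nat \<Rightarrow> nat \<Rightarrow> int" where
  "affine_C_entry n i j =
     (if i = j then 2
      else if i = 1 \<and> j = 2 then - 2
      else if i = n \<and> j = n - 1 then - 2
      else if j = i + 1 \<or> i = j + 1 then - 1
      else 0)"

(* Type C_{n-1}^{(1)}: n is the size of the matrix, so the affine rank is n - 1.
   Library matrices are indexed from 0, whence the shift. *)
definition affine_C_cartan :: "nat \<Rightarrow> int mat" where
  "affine_C_cartan n = mat n n (\<lambda>(i, j). affine_C_entry n (i + 1) (j + 1))"

end

theory Submission
  imports Defs
begin

text \<open>
  Since \<open>x I - C\<close> is tridiagonal, its leading principal minors obey the three-term recurrence of a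
  continuant (\<open>det_tridiagonal_step\<close>).  Put \<open>y = x - 2\<close>, the common diagonal entry.  Products of
  opposite off-diagonal entries equal \<open>1\<close> in the interior and \<open>2\<close> at either end, so the proper
  minors satisfy \<open>E\<^sub>1 = y\<close>, \<open>E\<^sub>2 = y\<^sup>2 - 2\<close>, \<open>E\<^bsub>k+2\<^esub> = y E\<^bsub>k+1\<^esub> - E\<^sub>k\<close>
  for \<open>k \<ge> 1\<close>: they are \<open>2 T\<^sub>k(y / 2)\<close> with \<open>T\<close>
  the Chebyshev polynomials of the first kind.  The last step of the recurrence carries a factor
  \<open>2\<close> again and gives
  \<open>p\<^sub>n = y E\<^bsub>n-1\<^esub> - 2 E\<^bsub>n-2\<^esub> = E\<^sub>n - E\<^bsub>n-2\<^esub> = (y\<^sup>2 - 4) U\<^bsub>n-2\<^esub>(y / 2)\<close>,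
  where \<open>E\<^sub>n\<close> continues the interior recurrence and \<open>U\<close> denotes the Chebyshev polynomials of the
  second kind.  Here \<open>y\<^sup>2 - 4 = x (x - 4)\<close>, and expanding \<open>U\<^bsub>n-2\<^esub>(x / 2 - 1)\<close> in powers of \<open>x\<close> yields
  the alternating binomial sum, because applying Pascal's rule twice reproduces the Chebyshev
  recurrence on coefficients (\<open>coeff_shifted_chebyshev_U\<close>).
\<close>

text \<open>
  Expand along the last row, whose two surviving entries leave the leading minor of size \<open>n + 1\<close> and
  a minor whose last column is again zero except for its bottom entry.
\<close>

lemma det_tridiagonal_step:
  fixes f :: "nat \<Rightarrow> nat \<Rightarrow> 'a :: comm_ring_1"
  assumes row: "\<And>j. j < n \<Longrightarrow> f (Suc n) j = 0"
    and col: "\<And>i. i < n \<Longrightarrow> f i (Suc n) = 0"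
  shows "det (mat (n + 2) (n + 2) (\<lambda>(i, j). f i j)) =
    f (Suc n) (Suc n) * det (mat (Suc n) (Suc n) (\<lambda>(i, j). f i j)) -
    f n (Suc n) * f (Suc n) n * det (mat n n (\<lambda>(i, j). f i j))"
proof -
  let ?A = "mat (n + 2) (n + 2) (\<lambda>(i, j). f i j)"
  let ?B = "mat_delete ?A (Suc n) n"
  have "det ?B = (\<Sum>i<Suc n. ?B $$ (i, n) * cofactor ?B i n)"
    by (rule laplace_expansion_column) (auto simp: mat_delete_def)
  also have "\<dots> = f n (Suc n) * cofactor ?B n n"
    by (simp add: mat_delete_def col)
  also have "mat_delete ?B n n = mat n n (\<lambda>(i, j). f i j)"
    by (auto simp: mat_delete_def)
  then have "cofactor ?B n n = det (mat n n (\<lambda>(i, j). f i j))"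
    by (simp add: cofactor_def flip: mult_2)
  finally have B: "det ?B = f n (Suc n) * det (mat n n (\<lambda>(i, j). f i j))" .
  have last: "mat_delete ?A (Suc n) (Suc n) = mat (Suc n) (Suc n) (\<lambda>(i, j). f i j)"
    by (auto simp: mat_delete_def)
  have "det ?A = (\<Sum>j<n + 2. ?A $$ (Suc n, j) * cofactor ?A (Suc n) j)"
    by (rule laplace_expansion_row) auto
  also have "\<dots> = f (Suc n) n * cofactor ?A (Suc n) n +
      f (Suc n) (Suc n) * cofactor ?A (Suc n) (Suc n)"
    by (simp add: row)
  finally show ?thesis
    unfolding cofactor_def last B by (simp add: algebra_simps flip: mult_2)
qed

text \<open>
  \<open>shifted_chebyshev_U k\<close> is \<open>U\<^bsub>k-1\<^esub>(x / 2 - 1)\<close>; starting from \<open>U\<^bsub>-1\<^esub> = 0\<close> keeps the formulas below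
  free of case distinctions at small indices.
\<close>

fun shifted_chebyshev_U :: "nat \<Rightarrow> int poly" where
  "shifted_chebyshev_U 0 = 0"
| "shifted_chebyshev_U (Suc 0) = 1"
| "shifted_chebyshev_U (Suc (Suc k)) =
     [:-2, 1:] * shifted_chebyshev_U (Suc k) - shifted_chebyshev_U k"

lemma coeff_shifted_chebyshev_U:
  "coeff (shifted_chebyshev_U k) j = (- 1) ^ (k + j + 1) * int ((k + j) choose (2 * j + 1))"
proof (induction k arbitrary: j rule: shifted_chebyshev_U.induct)
  case 1
  then show ?case by simp
next
  case 2
  then show ?case
    by (cases j) (auto simp: binomial_eq_0)
next
  case (3 k)
  \<comment> \<open>The factor \<open>x - 2\<close> also brings in the coefficient at \<open>j - 1\<close>, absent for \<open>j = 0\<close>.\<close>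
  show ?case
  proof (cases j)
    case 0
    then show ?thesis by (simp add: 3 algebra_simps)
  next
    case (Suc i)
    \<comment> \<open>Pascal's rule twice: the second difference of \<open>N choose r\<close> in \<open>N\<close> is \<open>N choose (r - 2)\<close>.\<close>
    have "int ((k + i + 3) choose (2 * i + 3)) + int ((k + i + 1) choose (2 * i + 3)) =
        2 * int ((k + i + 2) choose (2 * i + 3)) + int ((k + i + 1) choose (2 * i + 1))"
      by (simp add: numeral_eq_Suc)
    then show ?thesis
      by (simp add: 3 Suc algebra_simps numeral_3_eq_3)
  qed
qed

lemma shifted_chebyshev_U_eq_sum:
  assumes "n \<ge> 2"
  shows "shifted_chebyshev_U (n - 1) =
    (\<Sum>j = 0..n - 2. monom ((- 1) ^ (n + j) * int ((n + j - 1) choose (2 * j + 1))) j)"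
proof -
  obtain m where n: "n = Suc (Suc m)"
    using assms by (metis add_2_eq_Suc le_Suc_ex)
  show ?thesis
    by (rule poly_eqI)
      (auto simp: n coeff_sum coeff_shifted_chebyshev_U binomial_eq_0)
qed

definition affine_C_char_entry :: "nat \<Rightarrow> nat \<Rightarrow> nat \<Rightarrow> int poly" where
  "affine_C_char_entry n i j =
     (if i = j then [:0, 1:] else 0) - [:affine_C_entry n (i + 1) (j + 1):]"

lemma char_poly_affine_C_cartan:
  "char_poly (affine_C_cartan n) = det (mat n n (\<lambda>(i, j). affine_C_char_entry n i j))"
  unfolding char_poly_def char_poly_matrix_def affine_C_cartan_def
  by (rule arg_cong[of _ _ det]) (auto simp: affine_C_char_entry_def)

text \<open>
  Size \<open>n\<close> is excluded because the last row of the full matrix meets the second double bond.  The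
  right-hand side is \<open>2 T\<^bsub>k+1\<^esub> = U\<^bsub>k+1\<^esub> - U\<^bsub>k-1\<^esub>\<close> at \<open>x / 2 - 1\<close>.
\<close>

lemma det_affine_C_leading_minor:
  assumes "Suc k < n"
  shows "det (mat (Suc k) (Suc k) (\<lambda>(i, j). affine_C_char_entry n i j)) =
    shifted_chebyshev_U (k + 2) - shifted_chebyshev_U k"
  using assms
proof (induction k rule: shifted_chebyshev_U.induct)
  case 1
  then show ?case
    by (simp add: det_single affine_C_char_entry_def affine_C_entry_def)
next
  case 2
  then show ?case
    using det_tridiagonal_step[of 0 "affine_C_char_entry n"]
    by (simp add: det_single affine_C_char_entry_def affine_C_entry_def numeral_poly)
next
  case (3 k)
  let ?e = "affine_C_char_entry n"
  let ?y = "[:-2, 1:] :: int poly"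
  let ?D = "\<lambda>k. det (mat k k (\<lambda>(i, j). ?e i j))"
  let ?U = shifted_chebyshev_U
  have entries: "?e (k + 2) (k + 2) = ?y" "?e (k + 1) (k + 2) = 1" "?e (k + 2) (k + 1) = 1"
    using "3.prems" by (auto simp: affine_C_char_entry_def affine_C_entry_def one_pCons)
  have "?D (Suc k + 2) = ?e (k + 2) (k + 2) * ?D (Suc (Suc k)) -
      ?e (k + 1) (k + 2) * ?e (k + 2) (k + 1) * ?D (Suc k)"
    by (subst det_tridiagonal_step) (auto simp: affine_C_char_entry_def affine_C_entry_def)
  also have "\<dots> = ?y * ?D (Suc (Suc k)) - ?D (Suc k)"
    by (simp only: entries mult_1_left)
  also have "\<dots> = ?y * (?U (Suc k + 2) - ?U (Suc k)) - (?U (k + 2) - ?U k)"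
    using 3 by (simp only: Suc_lessD)
  also have "\<dots> = ?U (Suc (Suc k) + 2) - ?U (Suc (Suc k))"
    by (simp add: algebra_simps)
  finally show ?case
    by simp
qed

theorem proposition3:
  fixes n :: nat
  assumes "n \<ge> 3"
  shows "char_poly (affine_C_cartan n) =
    [:0, 1:] * [:-4, 1:] *
      (\<Sum>j = 0..n - 2. monom ((- 1) ^ (n + j) * int ((n + j - 1) choose (2 * j + 1))) j)"
proof -
  obtain m where n: "n = m + 3"
    using assms by (metis add.commute le_Suc_ex)
  let ?y = "[:-2, 1:] :: int poly"
  let ?U = shifted_chebyshev_U
  let ?e = "affine_C_char_entry n"
  have "char_poly (affine_C_cartan n) = det (mat (Suc m + 2) (Suc m + 2) (\<lambda>(i, j). ?e i j))"
    by (simp add: char_poly_affine_C_cartan n numeral_3_eq_3)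
  also have "\<dots> = ?e (m + 2) (m + 2) * det (mat (Suc (Suc m)) (Suc (Suc m)) (\<lambda>(i, j). ?e i j)) -
      ?e (m + 1) (m + 2) * ?e (m + 2) (m + 1) * det (mat (Suc m) (Suc m) (\<lambda>(i, j). ?e i j))"
    by (subst det_tridiagonal_step) (auto simp: affine_C_char_entry_def affine_C_entry_def n)
  also have "?e (m + 2) (m + 2) = ?y"
    by (simp add: affine_C_char_entry_def affine_C_entry_def)
  \<comment> \<open>This product belongs to the second double bond, hence is not the interior value \<open>1\<close>.\<close>
  also have "?e (m + 1) (m + 2) * ?e (m + 2) (m + 1) = 2"
    by (simp add: affine_C_char_entry_def affine_C_entry_def n numeral_poly)
  also have "det (mat (Suc m) (Suc m) (\<lambda>(i, j). ?e i j)) = ?U (m + 2) - ?U m"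
    by (rule det_affine_C_leading_minor) (simp add: n)
  also have "det (mat (Suc (Suc m)) (Suc (Suc m)) (\<lambda>(i, j). ?e i j)) = ?U (m + 3) - ?U (m + 1)"
    using det_affine_C_leading_minor[of "Suc m" n] by (simp add: n numeral_3_eq_3)
  also have "?y * (?U (m + 3) - ?U (m + 1)) - 2 * (?U (m + 2) - ?U m) = (?y * ?y - 4) * ?U (m + 2)"
  proof -
    have "?U (m + 3) = ?y * ?U (m + 2) - ?U (m + 1)" and "?U (m + 2) = ?y * ?U (m + 1) - ?U m"
      by (simp_all add: numeral_eq_Suc)
    moreover have "y * ((y * (y * v - u) - v) - v) - 2 * ((y * v - u) - u) = (y * y - 4) * (y * v - u)"
      for y u v :: "int poly"
      by (simp add: algebra_simps)
    ultimately show ?thesis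
      by (simp only:)
  qed
  also have "?y * ?y - 4 = [:0, 1:] * [:-4, 1:]"
    by (simp add: numeral_poly)
  also have "?U (m + 2) = ?U (n - 1)"
    by (simp add: n)
  finally show ?thesis
    using assms by (simp only: shifted_chebyshev_U_eq_sum)
qed

end
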